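(* Let $M\in\mathbb N$. For any $g>0$, $\mathtt h\in(0,+\infty]$ and $\gamma\in\mathbb R$, there exists a zero measure set $\mathcal K\subset(0,+\infty)$ such that, for any compact interval $[\kappa_1,\kappa_2]\subset(0,+\infty)$, there is $\tau>0$ and, for any $\kappa\in[\kappa_1,\kappa_2]\setminus\mathcal K$, the following holds: there is $\nu>0$ such that for any multi-index $(\alpha,\beta)\in\mathbb N_0^{\mathbb Z\setminus\{0\}}\times\mathbb N_0^{\mathbb Z\setminus\{0\}}$ of length $|\alpha+\beta|\le M$ which is not super action preserving, it results $$|\vec\Omega(\kappa)\cdot(\alpha-\beta)|>\frac{\nu}{\Big(\max\limits_{j\in\mathrm{supp}(\alpha\cup\beta)}|j|\Big)^\tau},$$ where $\mathrm{supp}(\alpha\cup\beta)=\{j\in\mathbb Z\setminus\{0\}:\alpha_j+\beta_j\ne0\}$.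
   Context: $\mathbb N=\{1,2,\dots\}$, $\mathbb N_0=\mathbb N\cup\{0\}$. Set $\mathtt G(\xi)=\xi\tanh(\mathtt h\xi)$ if $0<\mathtt h<+\infty$ and $\mathtt G(\xi)=|\xi|$ if $\mathtt h=+\infty$. For $j\in\mathbb Z\setminus\{0\}$ and $\kappa>0$, $$\Omega_j(\kappa)=\omega_j(\kappa)+\frac\gamma2\frac{\mathtt G(j)}{j},\qquad \omega_j(\kappa)=\sqrt{\mathtt G(j)\Big(g+\kappa j^2+\frac{\gamma^2}{4}\frac{\mathtt G(j)}{j^2}\Big)},$$ $\vec\Omega(\kappa)=\{\Omega_j(\kappa)\}_{j\in\mathbb Z\setminus\{0\}}$ and $\vec\Omega(\kappa)\cdot(\alpha-\beta)=\sum_{j\ne0}\Omega_j(\kappa)(\alpha_j-\beta_j)$. For a multi-index, $|\alpha|=\sum_{j\neq 0}\alpha_j$. A multi-index $(\alpha,\beta)$ is super action preserving if $\alpha_n+\alpha_{-n}=\beta_n+\beta_{-n}$ for all $n\in\mathbb N$. *)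

theory Defs
  imports "HOL-Analysis.Analysis"
begin

definition depth_symbol :: "ereal \<Rightarrow> real \<Rightarrow> real" where
  "depth_symbol h \<xi> = (if h = \<infinity> then \<bar>\<xi>\<bar> else \<xi> * tanh (real_of_ereal h * \<xi>))"

definition omega :: "real \<Rightarrow> ereal \<Rightarrow> real \<Rightarrow> real \<Rightarrow> int \<Rightarrow> real" where
  "omega g h \<gamma> \<kappa> j =
     sqrt (depth_symbol h j *
       (g + \<kappa> * (real_of_int j)\<^sup>2 + \<gamma>\<^sup>2 / 4 * (depth_symbol h j / (real_of_int j)\<^sup>2)))"

definition Omega :: "real \<Rightarrow> ereal \<Rightarrow> real \<Rightarrow> real \<Rightarrow> int \<Rightarrow> real" where
  "Omega g h \<gamma> \<kappa> j = omega g h \<gamma> \<kappa> j + \<gamma> / 2 * (depth_symbol h j / real_of_int j)"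

abbreviation nonzero_ints :: "int set" where
  "nonzero_ints \<equiv> UNIV - {0}"

text \<open>Multi-indices are functions on the nonzero integers, represented as extensional
  functions; their value at \<open>0\<close> is never used. No finiteness of the support is imposed: the
  length takes values in the extended naturals and is infinite if the support is.\<close>

definition multi_indices :: "(int \<Rightarrow> nat) set" where
  "multi_indices = nonzero_ints \<rightarrow>\<^sub>E UNIV"

definition mi_length :: "(int \<Rightarrow> nat) \<Rightarrow> enat" where
  "mi_length \<alpha> = (\<Sum>\<^sub>\<infinity>j\<in>nonzero_ints. enat (\<alpha> j))"

definition mi_supp :: "(int \<Rightarrow> nat) \<Rightarrow> (int \<Rightarrow> nat) \<Rightarrow> int set" where
  "mi_supp \<alpha> \<beta> = {j \<in> nonzero_ints. \<alpha> j + \<beta> j \<noteq> 0}"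

definition super_action_preserving :: "(int \<Rightarrow> nat) \<Rightarrow> (int \<Rightarrow> nat) \<Rightarrow> bool" where
  "super_action_preserving \<alpha> \<beta> \<longleftrightarrow>
     (\<forall>n::nat. n \<ge> 1 \<longrightarrow> \<alpha> (int n) + \<alpha> (- int n) = \<beta> (int n) + \<beta> (- int n))"

definition freq_dot :: "(int \<Rightarrow> real) \<Rightarrow> (int \<Rightarrow> int) \<Rightarrow> real" where
  "freq_dot \<Theta> d = (\<Sum>\<^sub>\<infinity>j\<in>nonzero_ints. \<Theta> j * real_of_int (d j))"

end

theory Submission
  imports Defs
begin

text \<open>
  Put \<open>n = \<bar>j\<bar>\<close>. The frequency of the mode \<open>j\<close> is \<open>A\<^sub>n sqrt (\<kappa> + m\<^sub>n)\<close> plus a constant in \<open>\<kappa>\<close>, with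
  amplitudes \<open>A\<^sub>n\<close> bounded below and shifts \<open>m\<^sub>n = g / n\<^sup>2 + O(1 / n\<^sup>3)\<close> that strictly decrease in
  \<open>n\<close>. For a pair of multi-indices that is not super action preserving, the small divisor is
  therefore a function \<open>f(\<kappa>) = c + \<Sum> b\<^sub>n A\<^sub>n sqrt (\<kappa> + m\<^sub>n)\<close> with between one and \<open>2 M\<close> terms, all
  with nonzero integers \<open>b\<^sub>n\<close> (\<open>resonance_eq_sqrt_sum\<close>). Square roots with distinct shifts, together
  with the constants, are linearly independent, and quantitatively so, because the shifts of the
  modes up to \<open>N\<close> are at least \<open>g / N ^ 4\<close> apart (\<open>shift_gap\<close>).

  The quantitative independence is obtained from an iterated Rolle argument. If
  \<open>\<bar>f\<bar> \<le> \<epsilon>\<close> at many points with gaps at least \<open>\<eta>\<close>, then its derivative is at most \<open>2 \<epsilon> / \<eta>\<close> at half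
  as many points with the same gaps (\<open>spread_out_derivative\<close>). Differentiating once kills the constant
  \<open>c\<close>; afterwards, multiplying by a suitable power of \<open>\<kappa> + m\<^sub>n\<close> and differentiating kills one term at
  a time (\<open>power_sum_lower_bound\<close>). What remains at the end is a single term that is bounded below, so
  that \<open>\<epsilon>\<close> is bounded below by a power of \<open>\<eta> / N ^ 4\<close> (\<open>resonance_sublevel_not_spread_out\<close>). In other
  words, the sublevel sets of \<open>f\<close> at lower levels contain only boundedly many points with gaps
  \<open>\<eta>\<close>, and hence have measure \<open>O(\<eta>)\<close> (\<open>emeasure_le_if_not_spread_out\<close>). As the number of
  multi-indices supported on the modes up to \<open>N\<close> grows polynomially in \<open>N\<close>, a Borel-Cantelli argument
  finishes the proof (\<open>exceptional_set\<close>).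
\<close>

section \<open>Spread-out points in sublevel sets\<close>

definition spread_out :: "nat \<Rightarrow> real \<Rightarrow> real set \<Rightarrow> bool" where
  "spread_out n \<eta> E \<longleftrightarrow>
     (\<exists>p. (\<forall>i<n. p i \<in> E) \<and> (\<forall>i. Suc i < n \<longrightarrow> p i + \<eta> \<le> p (Suc i)))"

lemma spread_out_0 [simp]: "spread_out 0 \<eta> E"
  by (simp add: spread_out_def)

lemma spread_out_mono: "spread_out n \<eta> E \<Longrightarrow> n' \<le> n \<Longrightarrow> E \<subseteq> E' \<Longrightarrow> spread_out n' \<eta> E'"
  unfolding spread_out_def by (meson order.strict_trans2 subsetD)

lemma spread_out_nonempty: "spread_out n \<eta> E \<Longrightarrow> 0 < n \<Longrightarrow> E \<noteq> {}"
  unfolding spread_out_def by auto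

lemma spread_out_Suc:
  assumes "spread_out n \<eta> (E \<inter> {p + \<eta>..})" and "p \<in> E"
  shows "spread_out (Suc n) \<eta> E"
proof -
  obtain q where q: "\<And>i. i < n \<Longrightarrow> q i \<in> E \<inter> {p + \<eta>..}"
    "\<And>i. Suc i < n \<Longrightarrow> q i + \<eta> \<le> q (Suc i)"
    using assms(1) unfolding spread_out_def by blast
  have "(case_nat p q) i \<in> E" if "i < Suc n" for i
    using that q(1) assms(2) by (cases i) auto
  moreover have "(case_nat p q) i + \<eta> \<le> (case_nat p q) (Suc i)" if "Suc i < Suc n" for i
  proof (cases i)
    case 0
    then show ?thesis using q(1)[of 0] that by auto
  next
    case (Suc j)
    then show ?thesis using q(2)[of j] that by auto
  qed
  ultimately show ?thesis unfolding spread_out_def by blast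
qed

text \<open>A greedy choice of points from left to right: each chosen point, together with the stretch
  before it that is still close to the infimum, uses up a window of length \<open>2 \<eta>\<close>.\<close>

lemma emeasure_le_if_not_spread_out:
  assumes "E \<in> sets lebesgue" "bdd_below E" "0 < \<eta>" "\<not> spread_out n \<eta> E"
  shows "emeasure lebesgue E \<le> ennreal (2 * real n * \<eta>)"
  using assms
proof (induction n arbitrary: E)
  case 0
  then show ?case by simp
next
  case (Suc n)
  show ?case
  proof (cases "E = {}")
    case True
    then show ?thesis by simp
  next
    case False
    define a where "a = Inf E"
    obtain p where p: "p \<in> E" "p < a + \<eta>"
      using cInf_lessD[OF False, of "a + \<eta>"] Suc.prems unfolding a_def by auto
    define E' where "E' = E \<inter> {p + \<eta>..}"
    have E': "E' \<in> sets lebesgue" "bdd_below E'"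
      using Suc.prems by (auto simp: E'_def intro: bdd_below_mono)
    have "\<not> spread_out n \<eta> E'"
      using Suc.prems(4) spread_out_Suc p(1) unfolding E'_def by blast
    then have IH: "emeasure lebesgue E' \<le> ennreal (2 * real n * \<eta>)"
      using Suc.IH E' Suc.prems by blast
    have "E \<subseteq> {a..a + 2 * \<eta>} \<union> E'"
    proof
      fix x assume "x \<in> E"
      moreover from this have "a \<le> x"
        using Suc.prems(2) by (simp add: a_def cInf_lower)
      ultimately show "x \<in> {a..a + 2 * \<eta>} \<union> E'"
        using p by (auto simp: E'_def)
    qed
    then have "emeasure lebesgue E \<le> emeasure lebesgue ({a..a + 2 * \<eta>} \<union> E')"
      using E' by (intro emeasure_mono) auto
    also have "\<dots> \<le> emeasure lebesgue {a..a + 2 * \<eta>} + emeasure lebesgue E'"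
      using E' by (intro emeasure_subadditive) auto
    also have "\<dots> \<le> ennreal (2 * \<eta>) + ennreal (2 * real n * \<eta>)"
      using IH Suc.prems by (intro add_mono) auto
    also have "\<dots> = ennreal (2 * real (Suc n) * \<eta>)"
      using Suc.prems by (subst ennreal_plus[symmetric]) (auto simp: algebra_simps)
    finally show ?thesis .
  qed
qed

text \<open>A quantitative Rolle theorem. The mean value theorem is used only on every other gap between
  consecutive points, so that a full untouched gap separates the new points; this is why the number
  of points halves while the separation \<open>\<eta>\<close> survives.\<close>

lemma spread_out_derivative:
  assumes der: "\<And>x. x \<in> {u..v} \<Longrightarrow> (f has_real_derivative f' x) (at x)"
    and "0 < \<eta>"
    and sp: "spread_out (2 * n) \<eta> {x \<in> {u..v}. \<bar>f x\<bar> \<le> \<epsilon>}"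
  shows "spread_out n \<eta> {x \<in> {u..v}. \<bar>f' x\<bar> \<le> 2 * \<epsilon> / \<eta>}"
proof -
  obtain p where p: "\<And>i. i < 2 * n \<Longrightarrow> p i \<in> {u..v} \<and> \<bar>f (p i)\<bar> \<le> \<epsilon>"
    "\<And>i. Suc i < 2 * n \<Longrightarrow> p i + \<eta> \<le> p (Suc i)"
    using sp unfolding spread_out_def by blast
  have "\<exists>z. p (2 * i) < z \<and> z < p (Suc (2 * i)) \<and> \<bar>f' z\<bar> \<le> 2 * \<epsilon> / \<eta>" if "i < n" for i
  proof -
    let ?a = "p (2 * i)" and ?b = "p (Suc (2 * i))"
    have a: "?a \<in> {u..v}" "\<bar>f ?a\<bar> \<le> \<epsilon>" and b: "?b \<in> {u..v}" "\<bar>f ?b\<bar> \<le> \<epsilon>" and gap: "?a + \<eta> \<le> ?b"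
      using p(1)[of "2 * i"] p(1)[of "Suc (2 * i)"] p(2)[of "2 * i"] that by auto
    have ab: "?a < ?b" using gap \<open>0 < \<eta>\<close> by simp
    obtain z where z: "?a < z" "z < ?b" "f ?b - f ?a = (?b - ?a) * f' z"
      using MVT2[OF ab, of f f'] der a(1) b(1) by fastforce
    have "\<eta> * \<bar>f' z\<bar> \<le> (?b - ?a) * \<bar>f' z\<bar>"
      using gap by (intro mult_right_mono) auto
    also have "\<dots> = \<bar>f ?b - f ?a\<bar>" using z ab by (simp add: abs_mult)
    also have "\<dots> \<le> 2 * \<epsilon>" using a b by linarith
    finally show ?thesis using z \<open>0 < \<eta>\<close> by (auto simp: field_simps)
  qed
  then obtain q where q: "\<And>i. i < n \<Longrightarrow> p (2 * i) < q i \<and> q i < p (Suc (2 * i)) \<and> \<bar>f' (q i)\<bar> \<le> 2 * \<epsilon> / \<eta>"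
    by metis
  have "q i \<in> {x \<in> {u..v}. \<bar>f' x\<bar> \<le> 2 * \<epsilon> / \<eta>}" if "i < n" for i
    using q[OF that] p(1)[of "2 * i"] p(1)[of "Suc (2 * i)"] that by auto
  moreover have "q i + \<eta> \<le> q (Suc i)" if "Suc i < n" for i
    using q[of i] q[of "Suc i"] p(2)[of "Suc (2 * i)"] that by auto
  ultimately show ?thesis unfolding spread_out_def by blast
qed

section \<open>Lower bounds for sums of shifted powers\<close>

lemma powr_bounds:
  fixes R y t e :: real
  assumes "1 \<le> R" "1 / R \<le> y" "y \<le> R" "\<bar>t\<bar> \<le> e"
  shows "y powr t \<le> R powr e" "R powr (- e) \<le> y powr t"
proof -
  have y: "0 < y" using assms(1,2) by (smt (verit) divide_pos_pos)
  have "ln (1 / R) \<le> ln y" using assms by (subst ln_le_cancel_iff) (use y in auto)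
  then have "- ln R \<le> ln y" using assms by (simp add: ln_div)
  moreover have "ln y \<le> ln R" using assms y by simp
  ultimately have "\<bar>ln y\<bar> \<le> ln R" by linarith
  then have "\<bar>t\<bar> * \<bar>ln y\<bar> \<le> e * ln R" using assms by (intro mult_mono) auto
  then have "\<bar>t * ln y\<bar> \<le> e * ln R" by (simp add: abs_mult)
  then show "y powr t \<le> R powr e" "R powr (- e) \<le> y powr t"
    using y assms(1) by (auto simp: powr_def)
qed

text \<open>Elimination of one term at a time. After multiplication by \<open>(x + m\<^sub>0) powr s\<close> the term of
  index \<open>n\<^sub>0\<close> is constant, and by
  \<open>d/dx ((x + m\<^sub>0) / (x + m)) powr s = s (m - m\<^sub>0) (x + m\<^sub>0) powr (s - 1) (x + m) powr (- s - 1)\<close>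
  the derivative of the product is, up to the common factor \<open>s (x + m\<^sub>0) powr (s - 1)\<close>, a sum of the
  same shape with one term fewer, exponent \<open>- s - 1\<close>, and coefficients
  multiplied by \<open>m - m\<^sub>0\<close>. Each step costs a factor of order \<open>\<eta> \<delta>\<close>; when a single term is left,
  it cannot be small anywhere.\<close>

lemma power_sum_lower_bound:
  fixes m B :: "nat \<Rightarrow> real"
  assumes "finite S" "card S = Suc k" "1 \<le> R" "0 < \<eta>" "0 < \<delta>" "0 < \<beta>" "1 / 2 \<le> s"
    and "\<And>n x. n \<in> S \<Longrightarrow> x \<in> {u..v} \<Longrightarrow> 1 / R \<le> x + m n \<and> x + m n \<le> R"
    and "\<And>n n'. n \<in> S \<Longrightarrow> n' \<in> S \<Longrightarrow> n \<noteq> n' \<Longrightarrow> \<delta> \<le> \<bar>m n - m n'\<bar>"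
    and "\<And>n. n \<in> S \<Longrightarrow> \<beta> \<le> \<bar>B n\<bar>"
    and "spread_out (2 ^ k) \<eta> {x \<in> {u..v}. \<bar>\<Sum>n\<in>S. B n * (x + m n) powr (- s)\<bar> \<le> \<epsilon>}"
  shows "\<beta> * (\<delta> * \<eta> / 4) ^ k \<le> \<epsilon> * R powr (2 * (real k + 1) * (s + real k))"
  using assms
proof (induction k arbitrary: S B \<beta> s \<epsilon>)
  case 0
  then obtain n where S: "S = {n}" by (metis One_nat_def card_1_singletonE)
  obtain x where x: "x \<in> {u..v}" "\<bar>B n * (x + m n) powr (- s)\<bar> \<le> \<epsilon>"
    using spread_out_nonempty[OF 0(11)] S by auto
  have "R powr (- s) \<le> (x + m n) powr (- s)"
    using 0 x S by (intro powr_bounds) auto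
  then have "\<beta> * R powr (- s) \<le> \<bar>B n\<bar> * (x + m n) powr (- s)"
    using 0 S by (intro mult_mono) auto
  also have "\<dots> \<le> \<epsilon>" using x by (simp add: abs_mult)
  finally have 1: "\<beta> * R powr (- s) \<le> \<epsilon>" .
  then have "0 \<le> \<epsilon>" using \<open>0 < \<beta>\<close> by (meson mult_nonneg_nonneg less_imp_le order_trans powr_ge_zero)
  have "\<beta> = \<beta> * R powr (- s) * R powr s" using 0 by (simp add: powr_minus)
  also have "\<dots> \<le> \<epsilon> * R powr (2 * s)"
    using 0 1 \<open>0 \<le> \<epsilon>\<close> by (intro mult_mono) (auto intro!: powr_mono)
  finally show ?case by simp
next
  case (Suc k)
  obtain n0 where n0: "n0 \<in> S" using Suc.prems(2) by fastforce
  \<comment> \<open>\<open>F\<close> is the given sum, \<open>G\<close> its multiple with one constant term, and \<open>F1\<close> the derivative of \<open>G\<close>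
    without its common factor.\<close>
  define T where "T = S - {n0}"
  have T: "finite T" "card T = Suc k" "T \<subseteq> S" "n0 \<notin> T" "S = insert n0 T"
    using Suc.prems n0 by (auto simp: T_def)
  define F where "F x = (\<Sum>n\<in>S. B n * (x + m n) powr (- s))" for x
  define G where "G x = (x + m n0) powr s * F x" for x
  define F1 where "F1 x = (\<Sum>n\<in>T. (B n * (m n - m n0)) * (x + m n) powr (- (s + 1)))" for x
  have pos: "0 < x + m n" if "n \<in> S" "x \<in> {u..v}" for n x
    using Suc.prems(8)[OF that] Suc.prems(3) by (smt (verit) divide_pos_pos)
  have Gder: "(G has_real_derivative s * (x + m n0) powr (s - 1) * F1 x) (at x)" if x: "x \<in> {u..v}" for x
  proof -
    have px: "\<And>n. n \<in> S \<Longrightarrow> 0 < x + m n" using pos x by blast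
    then have p0: "0 < x + m n0" using n0 by blast
    have "(G has_real_derivative (s * (x + m n0) powr (s - 1) * F x
        + (x + m n0) powr s * (\<Sum>n\<in>S. B n * (- s * (x + m n) powr (- s - 1))))) (at x)"
      unfolding G_def F_def
      by (rule derivative_eq_intros refl px n0 | assumption)+ (simp add: mult_ac)
    moreover have "s * (x + m n0) powr (s - 1) * F x
        + (x + m n0) powr s * (\<Sum>n\<in>S. B n * (- s * (x + m n) powr (- s - 1)))
        = s * (x + m n0) powr (s - 1) * F1 x"
    proof -
      have e0: "(x + m n0) powr s = (x + m n0) powr (s - 1) * (x + m n0)"
        using p0 powr_add[of "x + m n0" "s - 1" 1] by simp
      have eS: "(x + m n) powr (- s) = (x + m n) powr (- s - 1) * (x + m n)" if "n \<in> S" for n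
        using pos[OF that x] powr_add[of "x + m n" "- s - 1" 1] by simp
      define P where "P = (x + m n0) powr (s - 1)"
      define Q where "Q n = B n * (x + m n) powr (- s - 1)" for n
      have F: "F x = (\<Sum>n\<in>S. Q n * (x + m n))"
        unfolding F_def Q_def by (intro sum.cong) (auto simp: eS)
      have Q: "(\<Sum>n\<in>S. B n * (- s * (x + m n) powr (- s - 1))) = - s * (\<Sum>n\<in>S. Q n)"
        unfolding Q_def sum_distrib_left by (intro sum.cong) auto
      have "s * P * F x + (P * (x + m n0)) * (- s * (\<Sum>n\<in>S. Q n))
        = s * P * ((\<Sum>n\<in>S. Q n * (x + m n)) - (\<Sum>n\<in>S. Q n * (x + m n0)))"
        unfolding F sum_distrib_right[symmetric] by (simp add: algebra_simps)
      also have "(\<Sum>n\<in>S. Q n * (x + m n)) - (\<Sum>n\<in>S. Q n * (x + m n0)) = (\<Sum>n\<in>S. Q n * (m n - m n0))"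
        unfolding sum_subtractf[symmetric] by (intro sum.cong) (auto simp: algebra_simps)
      also have "\<dots> = F1 x"
        unfolding F1_def Q_def \<open>S = insert n0 T\<close> using T by (simp add: mult_ac)
      finally show ?thesis unfolding e0 Q P_def .
    qed
    ultimately show ?thesis by simp
  qed
  have sG: "spread_out (2 * 2 ^ k) \<eta> {x \<in> {u..v}. \<bar>G x\<bar> \<le> R powr s * \<epsilon>}"
  proof (rule spread_out_mono[OF Suc.prems(11)])
    show "{x \<in> {u..v}. \<bar>\<Sum>n\<in>S. B n * (x + m n) powr (- s)\<bar> \<le> \<epsilon>} \<subseteq> {x \<in> {u..v}. \<bar>G x\<bar> \<le> R powr s * \<epsilon>}"
    proof safe
      fix x assume x: "x \<in> {u..v}" and le: "\<bar>\<Sum>n\<in>S. B n * (x + m n) powr (- s)\<bar> \<le> \<epsilon>"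
      have "(x + m n0) powr s \<le> R powr s"
        using Suc.prems(3,7) Suc.prems(8)[OF n0 x] by (intro powr_bounds) auto
      then show "\<bar>G x\<bar> \<le> R powr s * \<epsilon>"
        using le unfolding G_def F_def abs_mult by (intro mult_mono) auto
    qed
  qed simp
  have sG': "spread_out (2 ^ k) \<eta> {x \<in> {u..v}. \<bar>s * (x + m n0) powr (s - 1) * F1 x\<bar> \<le> 2 * (R powr s * \<epsilon>) / \<eta>}"
    by (rule spread_out_derivative[OF Gder \<open>0 < \<eta>\<close> sG])
  define \<epsilon>' where "\<epsilon>' = 4 * R powr (2 * s) * \<epsilon> / \<eta>"
  have sF1: "spread_out (2 ^ k) \<eta> {x \<in> {u..v}. \<bar>F1 x\<bar> \<le> \<epsilon>'}"
  proof (rule spread_out_mono[OF sG'])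
    show "{x \<in> {u..v}. \<bar>s * (x + m n0) powr (s - 1) * F1 x\<bar> \<le> 2 * (R powr s * \<epsilon>) / \<eta>}
      \<subseteq> {x \<in> {u..v}. \<bar>F1 x\<bar> \<le> \<epsilon>'}"
    proof safe
      fix x assume x: "x \<in> {u..v}"
        and le: "\<bar>s * (x + m n0) powr (s - 1) * F1 x\<bar> \<le> 2 * (R powr s * \<epsilon>) / \<eta>"
      have "R powr (- s) \<le> (x + m n0) powr (s - 1)"
        using Suc.prems(3,7) Suc.prems(8)[OF n0 x] by (intro powr_bounds) auto
      then have "1 / 2 * R powr (- s) * \<bar>F1 x\<bar> \<le> s * (x + m n0) powr (s - 1) * \<bar>F1 x\<bar>"
        using Suc.prems(7) by (intro mult_right_mono mult_mono) auto
      also have "\<dots> \<le> 2 * (R powr s * \<epsilon>) / \<eta>"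
        using le Suc.prems(7) by (simp add: abs_mult)
      finally have "\<bar>F1 x\<bar> \<le> 2 * R powr s * (2 * (R powr s * \<epsilon>) / \<eta>)"
        using Suc.prems(3) by (simp add: powr_minus field_simps)
      also have "\<dots> = \<epsilon>'"
        unfolding \<epsilon>'_def mult_2[of s] powr_add by simp
      finally show "\<bar>F1 x\<bar> \<le> \<epsilon>'" .
    qed
  qed simp
  have "(\<beta> * \<delta>) * (\<delta> * \<eta> / 4) ^ k \<le> \<epsilon>' * R powr (2 * (real k + 1) * (s + 1 + real k))"
  proof (rule Suc.IH[OF T(1,2)])
    show "\<beta> * \<delta> \<le> \<bar>B n * (m n - m n0)\<bar>" if "n \<in> T" for n
      unfolding abs_mult using Suc.prems that n0 T by (intro mult_mono) auto
    show "spread_out (2 ^ k) \<eta> {x \<in> {u..v}. \<bar>\<Sum>n\<in>T. B n * (m n - m n0) * (x + m n) powr - (s + 1)\<bar> \<le> \<epsilon>'}"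
      using sF1 by (simp add: F1_def)
  qed (use Suc.prems T in auto)
  then have "(\<beta> * \<delta>) * (\<delta> * \<eta> / 4) ^ k * (\<eta> / 4) \<le> \<epsilon>' * R powr (2 * (real k + 1) * (s + 1 + real k)) * (\<eta> / 4)"
    using \<open>0 < \<eta>\<close> by (intro mult_right_mono) auto
  then have le: "\<beta> * (\<delta> * \<eta> / 4) ^ Suc k \<le> \<epsilon> * (R powr (2 * s) * R powr (2 * (real k + 1) * (s + 1 + real k)))"
    using \<open>0 < \<eta>\<close> by (simp add: \<epsilon>'_def field_simps)
  obtain x where "\<bar>F1 x\<bar> \<le> \<epsilon>'"
    using spread_out_nonempty[OF sF1] by auto
  then have "0 \<le> \<epsilon>'" by linarith
  then have "0 \<le> \<epsilon>" using \<open>0 < \<eta>\<close> \<open>1 \<le> R\<close> by (simp add: \<epsilon>'_def zero_le_divide_iff zero_le_mult_iff)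
  have "\<epsilon> * (R powr (2 * s) * R powr (2 * (real k + 1) * (s + 1 + real k)))
     \<le> \<epsilon> * R powr (2 * (real (Suc k) + 1) * (s + real (Suc k)))"
    unfolding powr_add[symmetric] using Suc.prems(3,7) \<open>0 \<le> \<epsilon>\<close>
    by (intro mult_left_mono powr_mono) (auto simp: algebra_simps)
  with le show ?case by linarith
qed

text \<open>One differentiation removes the additive constant, here the contribution of the vorticity that
  does not depend on the surface tension, and leads to the exponent \<open>- 1 / 2\<close>. The exponents are
  coarsened so that they depend only on the bound \<open>L\<close> for the number of terms.\<close>

lemma sqrt_sum_lower_bound:
  fixes m B :: "nat \<Rightarrow> real"
  assumes S: "finite S" "S \<noteq> {}" "card S \<le> L"
    and "1 \<le> R" "0 < \<eta>" "\<eta> \<le> 1" "0 < \<delta>" "\<delta> \<le> 4" "0 < \<beta>"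
    and rng: "\<And>n x. n \<in> S \<Longrightarrow> x \<in> {u..v} \<Longrightarrow> 1 / R \<le> x + m n \<and> x + m n \<le> R"
    and gap: "\<And>n n'. n \<in> S \<Longrightarrow> n' \<in> S \<Longrightarrow> n \<noteq> n' \<Longrightarrow> \<delta> \<le> \<bar>m n - m n'\<bar>"
    and B: "\<And>n. n \<in> S \<Longrightarrow> \<beta> \<le> \<bar>B n\<bar>"
    and sp: "spread_out (2 ^ L) \<eta> {x \<in> {u..v}. \<bar>c + (\<Sum>n\<in>S. B n * sqrt (x + m n))\<bar> \<le> \<epsilon>}"
  shows "\<beta> * (\<delta> * \<eta> / 4) ^ L \<le> 4 * \<epsilon> * R ^ (2 * L\<^sup>2)"
proof -
  obtain k where k: "card S = Suc k" using S by (metis card_eq_0_iff not0_implies_Suc)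
  have pos: "0 < x + m n" if "n \<in> S" "x \<in> {u..v}" for n x
    using rng[OF that] \<open>1 \<le> R\<close> by (smt (verit) divide_pos_pos)
  have der: "((\<lambda>x. c + (\<Sum>n\<in>S. B n * sqrt (x + m n))) has_real_derivative
      (\<Sum>n\<in>S. B n / 2 * (x + m n) powr (- (1 / 2)))) (at x)" if x: "x \<in> {u..v}" for x
  proof -
    have "((\<lambda>x. c + (\<Sum>n\<in>S. B n * sqrt (x + m n))) has_real_derivative
        0 + (\<Sum>n\<in>S. B n / 2 * (x + m n) powr (- (1 / 2)))) (at x)"
    proof (intro DERIV_add DERIV_sum DERIV_const)
      fix n assume "n \<in> S"
      then have "0 < x + m n" using pos x by blast
      then show "((\<lambda>x. B n * sqrt (x + m n)) has_real_derivative B n / 2 * (x + m n) powr (- (1 / 2))) (at x)"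
        by (auto intro!: derivative_eq_intros simp: powr_minus powr_half_sqrt field_simps)
    qed
    then show ?thesis by simp
  qed
  have "spread_out (2 * 2 ^ k) \<eta> {x \<in> {u..v}. \<bar>c + (\<Sum>n\<in>S. B n * sqrt (x + m n))\<bar> \<le> \<epsilon>}"
    using S(3) k by (intro spread_out_mono[OF sp]) (auto simp flip: power_Suc intro!: power_increasing)
  note sp' = this
  have "spread_out (2 ^ k) \<eta>
      {x \<in> {u..v}. \<bar>\<Sum>n\<in>S. B n / 2 * (x + m n) powr (- (1 / 2))\<bar> \<le> 2 * \<epsilon> / \<eta>}"
    by (rule spread_out_derivative[OF der \<open>0 < \<eta>\<close> sp'])
  note sp'' = this
  have le: "\<beta> / 2 * (\<delta> * \<eta> / 4) ^ k \<le> 2 * \<epsilon> / \<eta> * R powr (2 * (real k + 1) * (1 / 2 + real k))"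
  proof (rule power_sum_lower_bound[OF S(1) k \<open>1 \<le> R\<close> \<open>0 < \<eta>\<close> \<open>0 < \<delta>\<close>])
    show "\<beta> / 2 \<le> \<bar>B n / 2\<bar>" if "n \<in> S" for n
      using B[OF that] by simp
  qed (use \<open>0 < \<beta>\<close> rng gap sp'' in auto)
  obtain x where "\<bar>c + (\<Sum>n\<in>S. B n * sqrt (x + m n))\<bar> \<le> \<epsilon>"
    using spread_out_nonempty[OF sp] by auto
  then have "\<epsilon> \<ge> 0" by linarith
  have dn: "0 < \<delta> * \<eta>" "\<delta> * \<eta> \<le> 4"
    using assms mult_mono[of \<delta> 4 \<eta> 1] by auto
  have "\<beta> * (\<delta> * \<eta> / 4) ^ L \<le> \<beta> * (\<delta> * \<eta> / 4) ^ Suc k"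
    using dn S(3) k \<open>0 < \<beta>\<close> by (intro mult_left_mono power_decreasing) auto
  also have "\<dots> = (\<beta> / 2 * (\<delta> * \<eta> / 4) ^ k) * (\<delta> * \<eta> / 2)" by simp
  also have "\<dots> \<le> (2 * \<epsilon> / \<eta> * R powr (2 * (real k + 1) * (1 / 2 + real k))) * (\<delta> * \<eta> / 2)"
    using le dn by (intro mult_right_mono) auto
  also have "\<dots> = \<delta> * (\<epsilon> * R powr (2 * (real k + 1) * (1 / 2 + real k)))"
    using \<open>0 < \<eta>\<close> by simp
  also have "\<dots> \<le> 4 * (\<epsilon> * R powr real (2 * L\<^sup>2))"
  proof -
    have kL: "real k + 1 \<le> real L" using S(3) k by simp
    then have "(real k + 1) * (1 / 2 + real k) \<le> real L * real L"
      by (intro mult_mono) auto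
    then have "2 * (real k + 1) * (1 / 2 + real k) \<le> real (2 * L\<^sup>2)"
      unfolding mult.assoc by (simp only: of_nat_mult of_nat_numeral power2_eq_square)
    then show ?thesis
      using \<open>\<epsilon> \<ge> 0\<close> \<open>\<delta> \<le> 4\<close> \<open>0 < \<delta>\<close> \<open>1 \<le> R\<close> by (intro mult_mono powr_mono) auto
  qed
  also have "R powr real (2 * L\<^sup>2) = R ^ (2 * L\<^sup>2)"
    using \<open>1 \<le> R\<close> by (intro powr_realpow) simp
  finally show ?thesis by (simp only: mult.assoc)
qed

section \<open>The frequencies as functions of the surface tension\<close>

definition amplitude :: "ereal \<Rightarrow> nat \<Rightarrow> real" where
  "amplitude h n = sqrt (depth_symbol h n * (real n)\<^sup>2)"

definition shift :: "real \<Rightarrow> ereal \<Rightarrow> real \<Rightarrow> nat \<Rightarrow> real" where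
  "shift g h \<gamma> n = g / (real n)\<^sup>2 + \<gamma>\<^sup>2 / 4 * (depth_symbol h n / real n ^ 4)"

lemma depth_symbol_minus [simp]: "depth_symbol h (- \<xi>) = depth_symbol h \<xi>"
  by (simp add: depth_symbol_def)

text \<open>Only the even part of the frequency, of the form \<open>A\<^sub>n sqrt (\<kappa> + m\<^sub>n)\<close>, depends on \<open>\<kappa>\<close>.
  Therefore the modes \<open>j\<close> and \<open>- j\<close> are indistinguishable for a variation of \<open>\<kappa>\<close>.\<close>

lemma Omega_eq:
  assumes "j \<noteq> 0"
  shows "Omega g h \<gamma> \<kappa> j = amplitude h (nat \<bar>j\<bar>) * sqrt (\<kappa> + shift g h \<gamma> (nat \<bar>j\<bar>))
    + \<gamma> / 2 * (depth_symbol h j / real_of_int j)"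
proof -
  define G where "G = depth_symbol h (real_of_int j)"
  have G: "depth_symbol h \<bar>real_of_int j\<bar> = G"
    by (simp add: G_def abs_if)
  have "G * (g + \<kappa> * (real_of_int j)\<^sup>2 + \<gamma>\<^sup>2 / 4 * (G / (real_of_int j)\<^sup>2))
     = G * (real_of_int j)\<^sup>2 * (\<kappa> + (g / (real_of_int j)\<^sup>2 + \<gamma>\<^sup>2 / 4 * (G / real_of_int j ^ 4)))"
    using assms by (simp add: field_simps power4_eq_xxxx power2_eq_square)
  then show ?thesis
    unfolding Omega_def omega_def amplitude_def shift_def real_sqrt_mult[symmetric]
    by (simp add: G G_def[symmetric])
qed

text \<open>Concavity of \<open>tanh\<close> on the positive half-line, in the form that \<open>tanh x / x\<close> decreases.\<close>

lemma tanh_mult_le: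
  fixes a x :: real
  assumes "1 \<le> a" "0 \<le> x"
  shows "tanh (a * x) \<le> a * tanh x"
proof -
  have "a * tanh 0 - tanh (a * 0) \<le> a * tanh x - tanh (a * x)"
  proof (rule DERIV_nonneg_imp_nondecreasing[OF \<open>0 \<le> x\<close>])
    fix y :: real assume y: "0 \<le> y" "y \<le> x"
    have "tanh y \<le> tanh (a * y)" "0 \<le> tanh y"
      using assms y mult_right_mono[of 1 a y] by auto
    then have "0 \<le> a * (1 - (tanh y)\<^sup>2) - a * (1 - (tanh (a * y))\<^sup>2)"
      using assms by (simp add: power_mono)
    moreover have "((\<lambda>y. a * tanh y - tanh (a * y)) has_real_derivative
        a * (1 - (tanh y)\<^sup>2) - a * (1 - (tanh (a * y))\<^sup>2)) (at y)"
      by (auto intro!: derivative_eq_intros)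
    ultimately show "\<exists>d. ((\<lambda>y. a * tanh y - tanh (a * y)) has_real_derivative d) (at y) \<and> 0 \<le> d"
      by blast
  qed
  then show ?thesis by simp
qed

text \<open>The lower bound is uniform in the mode, which keeps the amplitudes away from zero.\<close>

lemma depth_symbol_bounds:
  assumes "0 < h"
  obtains t where "0 < t"
    "\<And>n. 1 \<le> n \<Longrightarrow> t \<le> depth_symbol h (real n) \<and> depth_symbol h (real n) \<le> real n"
proof (cases h)
  case PInf
  then show ?thesis using that[of 1] by (auto simp: depth_symbol_def)
next
  case (real r)
  then have "0 < r" using assms by simp
  show ?thesis
  proof (rule that)
    show "0 < tanh r" using \<open>0 < r\<close> by simp
    fix n :: nat assume "1 \<le> n"
    then have "1 * tanh r \<le> real n * tanh (r * real n)"
      using \<open>0 < r\<close> by (intro mult_mono) auto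
    moreover have "real n * tanh (r * real n) \<le> real n * 1"
      by (intro mult_left_mono) (auto simp: tanh_real_lt_1 less_imp_le)
    ultimately show "tanh r \<le> depth_symbol h n \<and> depth_symbol h n \<le> n"
      using real by (simp add: depth_symbol_def)
  qed
qed (use assms in auto)

lemma depth_symbol_quotient_antimono:
  assumes "0 < h" "1 \<le> n" "n \<le> n'"
  shows "depth_symbol h (real n') / real n' ^ 4 \<le> depth_symbol h (real n) / real n ^ 4"
proof -
  have n: "0 < real n" "real n \<le> real n'" using assms by auto
  have nonneg: "0 \<le> depth_symbol h (real k)" for k
    using \<open>0 < h\<close> by (cases h) (auto simp: depth_symbol_def)
  have "depth_symbol h (real n') / (real n')\<^sup>2 \<le> depth_symbol h (real n) / (real n)\<^sup>2"
  proof (cases h)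
    case (real r)
    then have "0 < r" using assms by simp
    have "tanh (r * real n') = tanh (real n' / real n * (r * real n))"
      using n by simp
    also have "\<dots> \<le> real n' / real n * tanh (r * real n)"
      using n \<open>0 < r\<close> by (intro tanh_mult_le) auto
    finally show ?thesis
      using n real by (simp add: depth_symbol_def field_simps power2_eq_square)
  qed (use n assms in \<open>auto simp: depth_symbol_def field_simps power2_eq_square\<close>)
  moreover have "0 \<le> depth_symbol h (real n')"
    using nonneg by blast
  moreover have "1 / (real n')\<^sup>2 \<le> 1 / (real n)\<^sup>2"
    using n by (auto intro!: divide_left_mono power_mono)
  ultimately have "depth_symbol h (real n') / (real n')\<^sup>2 * (1 / (real n')\<^sup>2)
      \<le> depth_symbol h (real n) / (real n)\<^sup>2 * (1 / (real n)\<^sup>2)"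
    using nonneg[of n] by (intro mult_mono) auto
  then show ?thesis by (simp add: power4_eq_xxxx power2_eq_square mult.assoc)
qed

text \<open>The gap comes from \<open>g / n\<^sup>2\<close> alone; the vorticity term also decreases in \<open>n\<close>, so it can only
  widen the gap. Here the positivity of the gravity \<open>g\<close> enters.\<close>

lemma shift_gap:
  assumes "0 < g" "0 < h" "1 \<le> n" "n < n'" "n' \<le> N"
  shows "g / real N ^ 4 \<le> shift g h \<gamma> n - shift g h \<gamma> n'"
proof -
  have n: "1 \<le> real n" "real n + 1 \<le> real n'" "real n' \<le> real N" using assms by auto
  have "1 / real N ^ 4 \<le> 1 / ((real n)\<^sup>2 * (real n')\<^sup>2)"
  proof -
    have "(real n)\<^sup>2 * (real n')\<^sup>2 \<le> (real N)\<^sup>2 * (real N)\<^sup>2"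
      using n by (intro mult_mono power_mono) auto
    then have "(real n)\<^sup>2 * (real n')\<^sup>2 \<le> real N ^ 4"
      by (simp flip: power_add)
    then show ?thesis
      using n by (intro divide_left_mono) auto
  qed
  also have "\<dots> \<le> ((real n')\<^sup>2 - (real n)\<^sup>2) / ((real n)\<^sup>2 * (real n')\<^sup>2)"
  proof (rule divide_right_mono)
    have "(real n + 1)\<^sup>2 \<le> (real n')\<^sup>2" using n by (intro power_mono) auto
    then show "1 \<le> (real n')\<^sup>2 - (real n)\<^sup>2" using n by (simp add: power2_sum)
  qed simp
  also have "\<dots> = 1 / (real n)\<^sup>2 - 1 / (real n')\<^sup>2"
    using n by (simp add: field_simps)
  finally have "g * (1 / real N ^ 4) \<le> g * (1 / (real n)\<^sup>2 - 1 / (real n')\<^sup>2)"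
    using \<open>0 < g\<close> by (intro mult_left_mono) auto
  moreover have "\<gamma>\<^sup>2 / 4 * (depth_symbol h n' / real n' ^ 4) \<le> \<gamma>\<^sup>2 / 4 * (depth_symbol h n / real n ^ 4)"
    using assms by (intro mult_left_mono depth_symbol_quotient_antimono) auto
  ultimately show ?thesis by (simp add: shift_def algebra_simps)
qed

lemma shift_bounds:
  assumes "0 < g" "0 < h" "1 \<le> n"
  shows "0 \<le> shift g h \<gamma> n" "shift g h \<gamma> n \<le> g + \<gamma>\<^sup>2 / 4"
proof -
  obtain t where "0 < t" and t: "t \<le> depth_symbol h n" "depth_symbol h n \<le> n"
    using depth_symbol_bounds[OF \<open>0 < h\<close>] \<open>1 \<le> n\<close> by metis
  then show "0 \<le> shift g h \<gamma> n" using \<open>0 < g\<close> by (simp add: shift_def)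
  have n: "1 \<le> real n" using assms by simp
  have "g / (real n)\<^sup>2 \<le> g"
    using n \<open>0 < g\<close> by (simp add: divide_le_eq one_le_power)
  moreover have "depth_symbol h n / real n ^ 4 \<le> 1"
    using n order_trans[OF t(2) self_le_power[of "real n" 4]] by (simp add: divide_le_eq)
  ultimately show "shift g h \<gamma> n \<le> g + \<gamma>\<^sup>2 / 4"
    unfolding shift_def by (intro add_mono mult_left_le) auto
qed

section \<open>Multi-indices of bounded length\<close>

definition modes :: "nat \<Rightarrow> int set" where
  "modes N = {- int N..int N} - {0}"

lemma finite_modes [simp]: "finite (modes N)"
  by (simp add: modes_def)

lemma sum_modes:
  fixes f :: "int \<Rightarrow> 'a::comm_monoid_add"
  shows "(\<Sum>j\<in>modes N. f j) = (\<Sum>n = 1..N. f (int n) + f (- int n))"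
proof (induction N)
  case 0
  then show ?case by (simp add: modes_def)
next
  case (Suc N)
  have "modes (Suc N) = insert (int (Suc N)) (insert (- int (Suc N)) (modes N))"
    unfolding modes_def by auto
  moreover have "int (Suc N) \<notin> insert (- int (Suc N)) (modes N)" "- int (Suc N) \<notin> modes N"
    by (auto simp: modes_def)
  ultimately show ?case using Suc by (simp add: add_ac)
qed

lemma mi_length_le_imp:
  assumes "mi_length \<alpha> \<le> enat M" "finite F" "F \<subseteq> nonzero_ints"
  shows "(\<Sum>j\<in>F. \<alpha> j) \<le> M"
proof -
  have "(\<Sum>j\<in>F. enat (\<alpha> j)) \<le> mi_length \<alpha>"
    unfolding mi_length_def
    by (subst nonneg_infsum_complete) (use assms in \<open>auto intro!: SUP_upper\<close>)
  moreover have "(\<Sum>j\<in>F. enat (\<alpha> j)) = enat (\<Sum>j\<in>F. \<alpha> j)"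
    using assms(2) by (induction F) (auto simp: zero_enat_def)
  ultimately show ?thesis
    using assms(1) by (metis enat_ord_simps(1) order_trans)
qed

lemma finite_support:
  assumes "mi_length \<alpha> \<le> enat M"
  shows "finite {j \<in> nonzero_ints. \<alpha> j \<noteq> 0}"
proof (rule ccontr)
  assume "infinite {j \<in> nonzero_ints. \<alpha> j \<noteq> 0}"
  then obtain F where F: "finite F" "card F = Suc M" "F \<subseteq> {j \<in> nonzero_ints. \<alpha> j \<noteq> 0}"
    using infinite_arbitrarily_large by blast
  then have "(\<Sum>j\<in>F. 1) \<le> (\<Sum>j\<in>F. \<alpha> j)"
    by (intro sum_mono) force
  also have "\<dots> \<le> M"
    using F by (intro mi_length_le_imp[OF assms]) auto
  finally show False using F by simp
qed

lemma freq_dot_eq_sum_modes: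
  assumes "\<And>j. j \<noteq> 0 \<Longrightarrow> j \<notin> modes N \<Longrightarrow> d j = 0"
  shows "freq_dot \<Theta> d = (\<Sum>j\<in>modes N. \<Theta> j * real_of_int (d j))"
proof -
  have "freq_dot \<Theta> d = infsum (\<lambda>j. \<Theta> j * real_of_int (d j)) (modes N)"
    unfolding freq_dot_def by (rule infsum_cong_neutral) (use assms in \<open>auto simp: modes_def\<close>)
  then show ?thesis by simp
qed

definition bounded_indices :: "nat \<Rightarrow> nat \<Rightarrow> (int \<Rightarrow> nat) set" where
  "bounded_indices M N =
     {\<alpha> \<in> multi_indices. (\<forall>j. j \<noteq> 0 \<longrightarrow> j \<notin> modes N \<longrightarrow> \<alpha> j = 0) \<and> (\<Sum>j\<in>modes N. \<alpha> j) \<le> M}"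

text \<open>The element \<open>z\<close> pads the list, so that multiplicities with a sum below \<open>M\<close> are also
  represented by lists of length exactly \<open>M\<close>.\<close>

lemma ex_list_of_multiplicities:
  assumes "finite A" "(\<Sum>j\<in>A. \<alpha> j) \<le> M" "z \<notin> A"
  shows "\<exists>xs. length xs = M \<and> set xs \<subseteq> insert z A \<and> (\<forall>j\<in>A. count_list xs j = \<alpha> j)"
  using assms(2)
proof (induction M arbitrary: \<alpha>)
  case 0
  then show ?case using \<open>finite A\<close> by auto
next
  case (Suc M)
  show ?case
  proof (cases "\<exists>i\<in>A. \<alpha> i \<noteq> 0")
    case True
    then obtain i where i: "i \<in> A" "\<alpha> i \<noteq> 0" by blast
    have "(\<Sum>j\<in>A. \<alpha> j) = \<alpha> i + (\<Sum>j\<in>A - {i}. \<alpha> j)"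
      using \<open>finite A\<close> i by (simp add: sum.remove)
    moreover have "(\<Sum>j\<in>A. (\<alpha>(i := \<alpha> i - 1)) j) = (\<alpha> i - 1) + (\<Sum>j\<in>A - {i}. \<alpha> j)"
      using \<open>finite A\<close> i by (simp add: sum.remove)
    ultimately have "(\<Sum>j\<in>A. (\<alpha>(i := \<alpha> i - 1)) j) \<le> M"
      using i(2) Suc.prems by linarith
    from Suc.IH[OF this] obtain xs where xs: "length xs = M" "set xs \<subseteq> insert z A"
      "\<forall>j\<in>A. count_list xs j = (\<alpha>(i := \<alpha> i - 1)) j" by blast
    then have "length (i # xs) = Suc M \<and> set (i # xs) \<subseteq> insert z A \<and> (\<forall>j\<in>A. count_list (i # xs) j = \<alpha> j)"
      using i by auto
    then show ?thesis by blast
  next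
    case False
    have "\<forall>j\<in>A. count_list (replicate (Suc M) z) j = 0"
      using \<open>z \<notin> A\<close> by (auto simp: count_list_0_iff)
    then show ?thesis using False by (intro exI[of _ "replicate (Suc M) z"]) auto
  qed
qed

text \<open>A multi-index is read off from a list of \<open>M\<close> modes by counting multiplicities, where the
  entry \<open>0\<close> serves as a blank; the lists are easy to count.\<close>

lemma finite_bounded_indices: "finite (bounded_indices M N)"
  and card_bounded_indices: "card (bounded_indices M N) \<le> (2 * N + 1) ^ M"
proof -
  define X where "X = {xs. set xs \<subseteq> {- int N..int N} \<and> length xs = M}"
  define to_index where
    "to_index xs = (\<lambda>j. if j = 0 then undefined else count_list xs j)" for xs :: "int list"
  have "bounded_indices M N \<subseteq> to_index ` X"
  proof
    fix \<alpha> assume \<alpha>: "\<alpha> \<in> bounded_indices M N"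
    then obtain xs where xs: "length xs = M" "set xs \<subseteq> insert 0 (modes N)"
        "\<forall>j\<in>modes N. count_list xs j = \<alpha> j"
      using ex_list_of_multiplicities[of "modes N" \<alpha> M 0]
      by (auto simp: bounded_indices_def modes_def)
    have "\<alpha> j = to_index xs j" for j
    proof -
      consider "j = 0" | "j \<in> modes N" | "j \<noteq> 0" "j \<notin> modes N" by blast
      then show ?thesis
      proof cases
        case 1
        then show ?thesis
          using \<alpha> by (auto simp: bounded_indices_def multi_indices_def to_index_def PiE_def extensional_def)
      next
        case 2
        then show ?thesis using xs by (auto simp: to_index_def modes_def)
      next
        case 3
        then have "j \<notin> set xs" using xs(2) by auto
        then show ?thesis using 3 \<alpha> by (auto simp: to_index_def bounded_indices_def count_list_0_iff)
      qed
    qed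
    moreover have "xs \<in> X" using xs by (auto simp: X_def modes_def)
    ultimately show "\<alpha> \<in> to_index ` X" by blast
  qed
  moreover have "finite X" "card X = (2 * N + 1) ^ M"
    unfolding X_def by (auto simp: finite_lists_length_eq card_lists_length_eq nat_add_distrib nat_mult_distrib)
  ultimately show "finite (bounded_indices M N)" "card (bounded_indices M N) \<le> (2 * N + 1) ^ M"
    by (auto intro: finite_surj) (metis surj_card_le)
qed

section \<open>Sublevel sets of a resonance function\<close>

definition resonance :: "real \<Rightarrow> ereal \<Rightarrow> real \<Rightarrow> (int \<Rightarrow> nat) \<Rightarrow> (int \<Rightarrow> nat) \<Rightarrow> real \<Rightarrow> real" where
  "resonance g h \<gamma> \<alpha> \<beta> \<kappa> = freq_dot (Omega g h \<gamma> \<kappa>) (\<lambda>j. int (\<alpha> j) - int (\<beta> j))"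

lemma resonance_eq_sum_modes:
  assumes "\<alpha> \<in> bounded_indices M N" "\<beta> \<in> bounded_indices M N"
  shows "resonance g h \<gamma> \<alpha> \<beta> \<kappa> =
    (\<Sum>j\<in>modes N. Omega g h \<gamma> \<kappa> j * real_of_int (int (\<alpha> j) - int (\<beta> j)))"
  unfolding resonance_def
  by (rule freq_dot_eq_sum_modes) (use assms in \<open>auto simp: bounded_indices_def\<close>)

text \<open>Grouping the modes \<open>n\<close> and \<open>- n\<close> leaves the integer coefficients
  \<open>b n = (\<alpha> n + \<alpha> (- n)) - (\<beta> n + \<beta> (- n))\<close>. Super action preservation says precisely that they
  all vanish.\<close>

lemma resonance_eq_sqrt_sum:
  assumes "\<alpha> \<in> bounded_indices M N" "\<beta> \<in> bounded_indices M N" "\<not> super_action_preserving \<alpha> \<beta>"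
  obtains S c and b :: "nat \<Rightarrow> int" where "S \<subseteq> {1..N}" "S \<noteq> {}" "card S \<le> 2 * M" "\<And>n. n \<in> S \<Longrightarrow> b n \<noteq> 0"
    "\<And>\<kappa>. resonance g h \<gamma> \<alpha> \<beta> \<kappa> = c + (\<Sum>n\<in>S. (b n * amplitude h n) * sqrt (\<kappa> + shift g h \<gamma> n))"
proof -
  define d where "d j = int (\<alpha> j) - int (\<beta> j)" for j
  define b where "b n = d (int n) + d (- int n)" for n
  define S where "S = {n \<in> {1..N}. b n \<noteq> 0}"
  define c where "c = (\<Sum>j\<in>modes N. \<gamma> / 2 * (depth_symbol h j / real_of_int j) * d j)"
  have \<alpha>: "\<And>j. j \<noteq> 0 \<Longrightarrow> j \<notin> modes N \<Longrightarrow> \<alpha> j = 0" "(\<Sum>j\<in>modes N. \<alpha> j) \<le> M"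
    and \<beta>: "\<And>j. j \<noteq> 0 \<Longrightarrow> j \<notin> modes N \<Longrightarrow> \<beta> j = 0" "(\<Sum>j\<in>modes N. \<beta> j) \<le> M"
    using assms by (auto simp: bounded_indices_def)
  have "S \<noteq> {}"
  proof -
    obtain n where n: "n \<ge> 1" "\<alpha> (int n) + \<alpha> (- int n) \<noteq> \<beta> (int n) + \<beta> (- int n)"
      using assms(3) by (auto simp: super_action_preserving_def)
    have "n \<le> N"
    proof (rule ccontr)
      assume "\<not> n \<le> N"
      then have "int n \<notin> modes N" "- int n \<notin> modes N" by (auto simp: modes_def)
      then show False using n \<alpha>(1) \<beta>(1) by auto
    qed
    moreover have "b n \<noteq> 0" using n(2) by (simp add: b_def d_def)
    ultimately show ?thesis using n(1) by (auto simp: S_def)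
  qed
  moreover have "card S \<le> 2 * M"
  proof -
    have "card S = (\<Sum>n\<in>S. 1)" by simp
    also have "\<dots> \<le> (\<Sum>n\<in>S. (\<alpha> (int n) + \<beta> (int n)) + (\<alpha> (- int n) + \<beta> (- int n)))"
      by (rule sum_mono) (auto simp: S_def b_def d_def)
    also have "\<dots> \<le> (\<Sum>n = 1..N. (\<alpha> (int n) + \<beta> (int n)) + (\<alpha> (- int n) + \<beta> (- int n)))"
      by (rule sum_mono2) (auto simp: S_def)
    also have "\<dots> = (\<Sum>j\<in>modes N. \<alpha> j) + (\<Sum>j\<in>modes N. \<beta> j)"
      unfolding sum_modes by (simp only: sum.distrib add_ac)
    finally show ?thesis using \<alpha> \<beta> by simp
  qed
  moreover have "resonance g h \<gamma> \<alpha> \<beta> \<kappa>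
      = c + (\<Sum>n\<in>S. (b n * amplitude h n) * sqrt (\<kappa> + shift g h \<gamma> n))" for \<kappa>
  proof -
    define A where "A n = amplitude h n * sqrt (\<kappa> + shift g h \<gamma> n)" for n
    have "resonance g h \<gamma> \<alpha> \<beta> \<kappa> = (\<Sum>j\<in>modes N. Omega g h \<gamma> \<kappa> j * real_of_int (d j))"
      unfolding resonance_eq_sum_modes[OF assms(1,2)] d_def ..
    also have "\<dots> = (\<Sum>j\<in>modes N. \<gamma> / 2 * (depth_symbol h j / real_of_int j) * d j + A (nat \<bar>j\<bar>) * d j)"
    proof (rule sum.cong[OF refl])
      fix j assume "j \<in> modes N"
      then have "j \<noteq> 0" by (simp add: modes_def)
      show "Omega g h \<gamma> \<kappa> j * real_of_int (d j) =
          \<gamma> / 2 * (depth_symbol h j / real_of_int j) * d j + A (nat \<bar>j\<bar>) * d j"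
        unfolding Omega_eq[OF \<open>j \<noteq> 0\<close>] A_def by (simp only: distrib_right add.commute)
    qed
    also have "\<dots> = c + (\<Sum>j\<in>modes N. A (nat \<bar>j\<bar>) * d j)"
      by (simp add: sum.distrib c_def)
    also have "(\<Sum>j\<in>modes N. A (nat \<bar>j\<bar>) * d j) = (\<Sum>n = 1..N. b n * A n)"
      unfolding sum_modes by (intro sum.cong) (auto simp: b_def algebra_simps)
    also have "\<dots> = (\<Sum>n\<in>S. b n * A n)"
      by (rule sum.mono_neutral_right) (auto simp: S_def)
    finally show ?thesis by (simp add: A_def mult.assoc)
  qed
  ultimately show ?thesis
    by (intro that[of S b c]) (auto simp: S_def)
qed

text \<open>The constant \<open>c0\<close> is independent of \<open>N\<close> and of the multi-indices, because the amplitudes, the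
  nonzero integer coefficients and the ranges of \<open>\<kappa> + m\<^sub>n\<close> are bounded uniformly. The only loss in
  \<open>N\<close> comes from the gaps between the shifts, of order \<open>N powr (- 4)\<close>.\<close>

lemma resonance_sublevel_not_spread_out:
  fixes g \<gamma> u v :: real and h :: ereal and M :: nat
  assumes "0 < g" "0 < h" "0 < u"
  obtains c0 where "0 < c0"
    "\<And>N \<alpha> \<beta> \<eta> \<epsilon>. \<lbrakk>1 \<le> N; \<alpha> \<in> bounded_indices M N; \<beta> \<in> bounded_indices M N;
      \<not> super_action_preserving \<alpha> \<beta>; 0 < \<eta>; \<eta> \<le> 1;
      spread_out (2 ^ (2 * M)) \<eta> {\<kappa> \<in> {u..v}. \<bar>resonance g h \<gamma> \<alpha> \<beta> \<kappa>\<bar> \<le> \<epsilon>}\<rbrakk>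
      \<Longrightarrow> c0 * (\<eta> / real N ^ 4) ^ (2 * M) \<le> \<epsilon>"
proof -
  obtain t where t: "0 < t"
    "\<And>n. 1 \<le> n \<Longrightarrow> t \<le> depth_symbol h (real n) \<and> depth_symbol h (real n) \<le> real n"
    by (rule depth_symbol_bounds[OF \<open>0 < h\<close>]) blast
  define R where "R = max (1 / u) (max 1 v + (g + \<gamma>\<^sup>2 / 4))"
  define e where "e = min g 4"
  define c0 where "c0 = sqrt t * (e / 4) ^ (2 * M) / (4 * R ^ (2 * (2 * M)\<^sup>2))"
  have "1 \<le> max 1 v + (g + \<gamma>\<^sup>2 / 4)" using \<open>0 < g\<close> by (intro add_increasing2) auto
  then have R: "1 \<le> R" "1 / u \<le> R" "v + (g + \<gamma>\<^sup>2 / 4) \<le> R" by (auto simp: R_def)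
  have e: "0 < e" "e \<le> 4" "e \<le> g" using \<open>0 < g\<close> by (auto simp: e_def)
  have "0 < c0" using t R e by (simp add: c0_def)
  moreover have "c0 * (\<eta> / real N ^ 4) ^ (2 * M) \<le> \<epsilon>"
    if N: "1 \<le> N" and ab: "\<alpha> \<in> bounded_indices M N" "\<beta> \<in> bounded_indices M N"
      "\<not> super_action_preserving \<alpha> \<beta>" and \<eta>: "0 < \<eta>" "\<eta> \<le> 1"
      and sp: "spread_out (2 ^ (2 * M)) \<eta> {\<kappa> \<in> {u..v}. \<bar>resonance g h \<gamma> \<alpha> \<beta> \<kappa>\<bar> \<le> \<epsilon>}"
    for N \<alpha> \<beta> \<eta> \<epsilon>
  proof -
    obtain S c and b :: "nat \<Rightarrow> int" where S: "S \<subseteq> {1..N}" "S \<noteq> {}" "card S \<le> 2 * M" "\<And>n. n \<in> S \<Longrightarrow> b n \<noteq> 0"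
      and eq: "\<And>\<kappa>. resonance g h \<gamma> \<alpha> \<beta> \<kappa> = c + (\<Sum>n\<in>S. (b n * amplitude h n) * sqrt (\<kappa> + shift g h \<gamma> n))"
      by (rule resonance_eq_sqrt_sum[OF ab, where g = g and h = h and \<gamma> = \<gamma>]) (rule that)
    have N1: "1 \<le> real N ^ 4" using N by (simp add: one_le_power)
    have "sqrt t * (e / real N ^ 4 * \<eta> / 4) ^ (2 * M) \<le> 4 * \<epsilon> * R ^ (2 * (2 * M)\<^sup>2)"
    proof (rule sqrt_sum_lower_bound[OF _ S(2,3) R(1) \<eta>])
      show "finite S" using S(1) finite_subset by blast
      show "0 < e / real N ^ 4" using N1 e by (intro divide_pos_pos) linarith+
      have "e / real N ^ 4 \<le> e / 1" using N1 N e by (intro divide_left_mono) auto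
      then show "e / real N ^ 4 \<le> 4" using e by simp
      show "0 < sqrt t" using t by simp
      show "1 / R \<le> x + shift g h \<gamma> n \<and> x + shift g h \<gamma> n \<le> R" if "n \<in> S" "x \<in> {u..v}" for n x
      proof -
        have n: "1 \<le> n" using that S by auto
        have "1 / R \<le> u" using R \<open>0 < u\<close> by (simp add: field_simps)
        then show ?thesis
          using that(2) R(3) shift_bounds[OF assms(1,2) n, of \<gamma>] by auto
      qed
      show "e / real N ^ 4 \<le> \<bar>shift g h \<gamma> n - shift g h \<gamma> n'\<bar>"
        if "n \<in> S" "n' \<in> S" "n \<noteq> n'" for n n'
      proof -
        have "e / real N ^ 4 \<le> g / real N ^ 4" using e by (intro divide_right_mono) auto
        moreover have "g / real N ^ 4 \<le> \<bar>shift g h \<gamma> n - shift g h \<gamma> n'\<bar>"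
          using that S(1) shift_gap[OF assms(1,2), of n n' N \<gamma>] shift_gap[OF assms(1,2), of n' n N \<gamma>]
          by (cases "n < n'") (auto simp: subset_iff)
        ultimately show ?thesis by linarith
      qed
      show "sqrt t \<le> \<bar>real_of_int (b n) * amplitude h n\<bar>" if "n \<in> S" for n
      proof -
        have n: "1 \<le> n" using that S by auto
        have "t * 1 \<le> depth_symbol h n * (real n)\<^sup>2"
          using t n by (intro mult_mono) (auto simp: one_le_power intro: order_trans[of 0 t])
        then have "sqrt t \<le> amplitude h n" by (simp add: amplitude_def)
        moreover have "1 \<le> \<bar>real_of_int (b n)\<bar>" using S(4)[OF that] by linarith
        moreover have "0 \<le> sqrt t" using t by simp
        ultimately have "1 * sqrt t \<le> \<bar>real_of_int (b n)\<bar> * \<bar>amplitude h n\<bar>"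
          by (intro mult_mono) auto
        then show ?thesis by (simp add: abs_mult)
      qed
      show "spread_out (2 ^ (2 * M)) \<eta> {x \<in> {u..v}. \<bar>c + (\<Sum>n\<in>S. real_of_int (b n) * amplitude h n * sqrt (x + shift g h \<gamma> n))\<bar> \<le> \<epsilon>}"
        using sp by (simp add: eq)
    qed
    moreover have "e / real N ^ 4 * \<eta> / 4 = (e / 4) * (\<eta> / real N ^ 4)" by simp
    ultimately have "sqrt t * ((e / 4) ^ (2 * M) * (\<eta> / real N ^ 4) ^ (2 * M)) \<le> 4 * \<epsilon> * R ^ (2 * (2 * M)\<^sup>2)"
      by (simp only: power_mult_distrib)
    moreover have "0 < 4 * R ^ (2 * (2 * M)\<^sup>2)" using R by simp
    ultimately show ?thesis
      unfolding c0_def by (simp add: divide_le_eq mult_ac)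
  qed
  ultimately show ?thesis by (rule that)
qed

section \<open>The exceptional set of surface tensions\<close>

lemma resonance_sublevel_measurable:
  assumes "\<alpha> \<in> bounded_indices M N" "\<beta> \<in> bounded_indices M N"
  shows "{\<kappa> \<in> {u..v}. \<bar>resonance g h \<gamma> \<alpha> \<beta> \<kappa>\<bar> \<le> \<epsilon>} \<in> sets lebesgue"
proof -
  have "continuous_on UNIV (resonance g h \<gamma> \<alpha> \<beta>)"
    unfolding resonance_eq_sum_modes[OF assms, abs_def] Omega_def omega_def
    by (intro continuous_intros)
  then have "closed {\<kappa>. \<bar>resonance g h \<gamma> \<alpha> \<beta> \<kappa>\<bar> \<le> \<epsilon>}"
    by (intro closed_Collect_le continuous_intros)
  then have "closed ({u..v} \<inter> {\<kappa>. \<bar>resonance g h \<gamma> \<alpha> \<beta> \<kappa>\<bar> \<le> \<epsilon>})"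
    by (intro closed_Int) auto
  moreover have "{u..v} \<inter> {\<kappa>. \<bar>resonance g h \<gamma> \<alpha> \<beta> \<kappa>\<bar> \<le> \<epsilon>}
      = {\<kappa> \<in> {u..v}. \<bar>resonance g h \<gamma> \<alpha> \<beta> \<kappa>\<bar> \<le> \<epsilon>}" by auto
  ultimately show ?thesis by (metis borel_closed sets_completionI_sets sets_lborel)
qed

text \<open>A Borel-Cantelli argument with \<open>L = 2 M\<close>. At most \<open>(2 N + 1) ^ L\<close> pairs of multi-indices
  live on the modes up to \<open>N\<close>, so their sublevel sets may each have measure of order
  \<open>\<eta> = 1 / (r N ^ (L + 2))\<close> and still have total measure \<open>O(1 / r)\<close> after summation over \<open>N\<close>. The
  level that forces this measure is of order \<open>(\<eta> / N ^ 4) ^ L\<close>, whence the exponent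
  \<open>\<tau> = L (L + 6)\<close>. Letting \<open>r\<close> tend to infinity, the parameters that are bad for every \<open>r\<close> form a
  null set.\<close>

lemma exceptional_set:
  fixes g \<gamma> u v :: real and h :: ereal and M :: nat
  defines "\<tau> \<equiv> 2 * M * (2 * M + 6)"
  assumes "0 < g" "0 < h" "0 < u"
  obtains K where "K \<in> null_sets lebesgue" "K \<subseteq> {u..v}"
    "\<And>\<kappa>. \<kappa> \<in> {u..v} - K \<Longrightarrow> \<exists>\<nu>>0. \<forall>N\<ge>1. \<forall>\<alpha>\<in>bounded_indices M N. \<forall>\<beta>\<in>bounded_indices M N.
       \<not> super_action_preserving \<alpha> \<beta> \<longrightarrow> \<nu> / real N ^ \<tau> < \<bar>resonance g h \<gamma> \<alpha> \<beta> \<kappa>\<bar>"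
proof -
  define L where "L = 2 * M"
  obtain c0 where c0: "0 < c0"
    and sublevel0: "\<And>N \<alpha> \<beta> \<eta> \<epsilon>. \<lbrakk>1 \<le> N; \<alpha> \<in> bounded_indices M N; \<beta> \<in> bounded_indices M N;
      \<not> super_action_preserving \<alpha> \<beta>; 0 < \<eta>; \<eta> \<le> 1;
      spread_out (2 ^ (2 * M)) \<eta> {\<kappa> \<in> {u..v}. \<bar>resonance g h \<gamma> \<alpha> \<beta> \<kappa>\<bar> \<le> \<epsilon>}\<rbrakk>
      \<Longrightarrow> c0 * (\<eta> / real N ^ 4) ^ (2 * M) \<le> \<epsilon>"
    by (rule resonance_sublevel_not_spread_out[OF assms(2-4), where M = M and \<gamma> = \<gamma> and v = v]) (rule that)
  note sublevel = sublevel0[folded L_def]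
  \<comment> \<open>The factor 2 turns the non-strict bound of the sublevel estimate into a contradiction.\<close>
  define \<nu> where "\<nu> r = c0 / (2 * real (Suc r) ^ L)" for r
  define E where "E r N = (\<lambda>(\<alpha>, \<beta>). {\<kappa> \<in> {u..v}. \<bar>resonance g h \<gamma> \<alpha> \<beta> \<kappa>\<bar> \<le> \<nu> r / real N ^ \<tau>})" for r N
  define Q where "Q N = {(\<alpha>, \<beta>) \<in> bounded_indices M N \<times> bounded_indices M N. \<not> super_action_preserving \<alpha> \<beta>}" for N
  define B where "B r n = (\<Union>p\<in>Q (Suc n). E r (Suc n) p)" for r n
  define C where "C = 2 * 6 ^ L * (1::real)"
  define s where "s = (\<Sum>n. 1 / real (Suc n) ^ 2)"
  have Q: "finite (Q N)" "card (Q N) \<le> (2 * N + 1) ^ L" for N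
  proof -
    have sub: "Q N \<subseteq> bounded_indices M N \<times> bounded_indices M N" by (auto simp: Q_def)
    moreover have fin: "finite (bounded_indices M N \<times> bounded_indices M N)"
      by (simp add: finite_bounded_indices)
    ultimately show "finite (Q N)" by (rule finite_subset)
    have "card (Q N) \<le> card (bounded_indices M N) * card (bounded_indices M N)"
      using card_mono[OF fin sub] by (simp add: card_cartesian_product)
    also have "\<dots> \<le> (2 * N + 1) ^ M * (2 * N + 1) ^ M"
      by (intro mult_mono card_bounded_indices) auto
    finally show "card (Q N) \<le> (2 * N + 1) ^ L" by (simp add: L_def mult_2 power_add)
  qed
  have E_sets: "E r N p \<in> sets lebesgue" if "p \<in> Q N" for r N p
    using that resonance_sublevel_measurable[of "fst p" M N "snd p"]
    by (simp add: Q_def E_def split_beta)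
  have B_sets: "B r n \<in> sets lebesgue" for r n
    unfolding B_def using Q E_sets by (intro sets.finite_UN) auto
  have E_le: "emeasure lebesgue (E r N p) \<le> ennreal (2 * 2 ^ L / (real (Suc r) * real N ^ (L + 2)))"
    if p: "p \<in> Q N" and N: "1 \<le> N" for r N p
  proof -
    obtain \<alpha> \<beta> where p_eq: "p = (\<alpha>, \<beta>)" by (cases p)
    then have ab: "\<alpha> \<in> bounded_indices M N" "\<beta> \<in> bounded_indices M N" "\<not> super_action_preserving \<alpha> \<beta>"
      using p by (auto simp: Q_def)
    have E_eq: "E r N p = {\<kappa> \<in> {u..v}. \<bar>resonance g h \<gamma> \<alpha> \<beta> \<kappa>\<bar> \<le> \<nu> r / real N ^ \<tau>}"
      by (simp add: E_def p_eq)
    define \<eta> where "\<eta> = 1 / (real (Suc r) * real N ^ (L + 2))"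
    have N0: "0 < real N" using N by simp
    have "1 * 1 \<le> real (Suc r) * real N ^ (L + 2)"
      using N by (intro mult_mono one_le_power) auto
    then have \<eta>: "0 < \<eta>" "\<eta> \<le> 1" using N0 by (auto simp: \<eta>_def)
    have "(\<eta> / real N ^ 4) ^ L = 1 / (real (Suc r) ^ L * real N ^ \<tau>)"
    proof -
      have "real N ^ (L + 2) * real N ^ 4 = real N ^ (L + 6)"
        by (simp only: power_add[symmetric] add.assoc) simp
      then have "\<eta> / real N ^ 4 = 1 / (real (Suc r) * real N ^ (L + 6))"
        by (simp only: \<eta>_def divide_divide_eq_left mult.assoc)
      then show ?thesis
        by (simp add: power_divide power_mult_distrib power_mult[symmetric] \<tau>_def L_def mult.commute del: of_nat_Suc)
    qed
    then have "c0 * (\<eta> / real N ^ 4) ^ L = 2 * (\<nu> r / real N ^ \<tau>)"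
      by (simp add: \<nu>_def)
    moreover have "0 < \<nu> r / real N ^ \<tau>"
      using c0 N0 by (simp add: \<nu>_def)
    ultimately have "\<not> c0 * (\<eta> / real N ^ 4) ^ L \<le> \<nu> r / real N ^ \<tau>" by linarith
    then have "\<not> spread_out (2 ^ L) \<eta> (E r N p)"
      unfolding E_eq using sublevel[OF N ab \<eta>] by blast
    moreover have "bdd_below (E r N p)" unfolding E_eq by (rule bdd_belowI[of _ u]) auto
    ultimately have "emeasure lebesgue (E r N p) \<le> ennreal (2 * real (2 ^ L) * \<eta>)"
      using E_sets[OF p] \<eta> by (intro emeasure_le_if_not_spread_out) auto
    then show ?thesis by (simp add: \<eta>_def)
  qed
  have B_le: "emeasure lebesgue (B r n) \<le> ennreal (C / real (Suc r) * (1 / real (Suc n) ^ 2))" for r n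
  proof -
    let ?N = "Suc n"
    have "emeasure lebesgue (B r n) \<le> (\<Sum>p\<in>Q ?N. emeasure lebesgue (E r ?N p))"
      unfolding B_def using Q E_sets by (intro emeasure_subadditive_finite) auto
    also have "\<dots> \<le> (\<Sum>p\<in>Q ?N. ennreal (2 * 2 ^ L / (real (Suc r) * real ?N ^ (L + 2))))"
      by (intro sum_mono E_le) auto
    also have "\<dots> = ennreal (real (card (Q ?N)) * (2 * 2 ^ L / (real (Suc r) * real ?N ^ (L + 2))))"
      by (subst ennreal_mult) (simp_all only: sum_constant ennreal_of_nat_eq_real_of_nat, auto)
    also have "\<dots> \<le> ennreal (C / real (Suc r) * (1 / real ?N ^ 2))"
    proof (rule ennreal_leI)
      have "real (card (Q ?N)) \<le> real ((2 * ?N + 1) ^ L)" using Q(2) by (rule of_nat_mono)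
      also have "\<dots> \<le> (3 * real ?N) ^ L"
        unfolding of_nat_power by (intro power_mono) auto
      finally have "real (card (Q ?N)) * (2 * 2 ^ L / (real (Suc r) * real ?N ^ (L + 2)))
          \<le> (3 * real ?N) ^ L * (2 * 2 ^ L / (real (Suc r) * real ?N ^ (L + 2)))"
        by (intro mult_right_mono) auto
      also have "\<dots> = 2 * (3 ^ L * 2 ^ L) / real (Suc r) * (1 / real ?N ^ 2)"
        by (simp add: power_mult_distrib power_add power2_eq_square mult_ac del: of_nat_Suc)
      also have "(3::real) ^ L * 2 ^ L = 6 ^ L" by (simp flip: power_mult_distrib)
      finally show "real (card (Q ?N)) * (2 * 2 ^ L / (real (Suc r) * real ?N ^ (L + 2)))
          \<le> C / real (Suc r) * (1 / real ?N ^ 2)" by (simp add: C_def)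
    qed
    finally show ?thesis .
  qed
  have summ: "summable (\<lambda>n. 1 / real (Suc n) ^ 2)"
    using inverse_power_summable[of 2, where 'a = real] by (subst summable_Suc_iff) (simp add: inverse_eq_divide)
  define K where "K = (\<Inter>r. \<Union>n. B r n)"
  have K_sets: "K \<in> sets lebesgue" unfolding K_def using B_sets by (intro sets.countable_INT sets.countable_UN) auto
  have K_le: "emeasure lebesgue K \<le> ennreal (C * s * inverse (real (Suc r)))" for r
  proof -
    have "emeasure lebesgue K \<le> emeasure lebesgue (\<Union>n. B r n)"
      using B_sets by (intro emeasure_mono sets.countable_UN) (auto simp: K_def)
    also have "\<dots> \<le> (\<Sum>n. emeasure lebesgue (B r n))"
      using B_sets by (intro emeasure_subadditive_countably) auto
    also have "\<dots> \<le> (\<Sum>n. ennreal (C / real (Suc r) * (1 / real (Suc n) ^ 2)))"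
      by (intro suminf_le B_le) auto
    also have "\<dots> = ennreal (\<Sum>n. C / real (Suc r) * (1 / real (Suc n) ^ 2))"
      using summ by (intro suminf_ennreal2 summable_mult) (auto simp: C_def)
    also have "(\<Sum>n. C / real (Suc r) * (1 / real (Suc n) ^ 2)) = C / real (Suc r) * s"
      unfolding s_def using summ by (rule suminf_mult)
    finally show ?thesis by (simp add: field_simps)
  qed
  have "(\<lambda>r. ennreal (C * s * inverse (real (Suc r)))) \<longlonglongrightarrow> ennreal (C * s * 0)"
    by (intro tendsto_ennrealI tendsto_mult tendsto_const LIMSEQ_inverse_real_of_nat)
  then have "emeasure lebesgue K \<le> ennreal (C * s * 0)"
    using K_le by (intro LIMSEQ_le_const) auto
  then have "K \<in> null_sets lebesgue" using K_sets by (intro null_setsI) auto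
  moreover have "K \<subseteq> {u..v}" by (auto simp: K_def B_def E_def split: prod.splits)
  moreover have "\<exists>\<nu>>0. \<forall>N\<ge>1. \<forall>\<alpha>\<in>bounded_indices M N. \<forall>\<beta>\<in>bounded_indices M N.
       \<not> super_action_preserving \<alpha> \<beta> \<longrightarrow> \<nu> / real N ^ \<tau> < \<bar>resonance g h \<gamma> \<alpha> \<beta> \<kappa>\<bar>"
    if \<kappa>: "\<kappa> \<in> {u..v} - K" for \<kappa>
  proof -
    obtain r where r: "\<And>n. \<kappa> \<notin> B r n" using \<kappa> by (auto simp: K_def)
    have "\<nu> r / real N ^ \<tau> < \<bar>resonance g h \<gamma> \<alpha> \<beta> \<kappa>\<bar>"
      if "N \<ge> 1" "\<alpha> \<in> bounded_indices M N" "\<beta> \<in> bounded_indices M N" "\<not> super_action_preserving \<alpha> \<beta>"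
      for N \<alpha> \<beta>
    proof -
      have "Suc (N - 1) = N" using that by simp
      then have "\<kappa> \<notin> E r N (\<alpha>, \<beta>)" using r[of "N - 1"] that by (auto simp: B_def Q_def)
      then show ?thesis using \<kappa> by (auto simp: E_def not_le)
    qed
    moreover have "0 < \<nu> r" using c0 by (simp add: \<nu>_def)
    ultimately show ?thesis by blast
  qed
  ultimately show ?thesis by (rule that)
qed

text \<open>The compact intervals \<open>[1 / q, q]\<close> exhaust the half-line, so the union of their exceptional sets
  serves all compact intervals at once. The relevant \<open>N\<close> is the largest modulus of a mode in the
  support.\<close>

theorem theoremB1:
  fixes M :: nat and g \<gamma> :: real and h :: ereal
  assumes "M \<ge> 1" and "g > 0" and "h > 0"
  shows "\<exists>K. K \<subseteq> {0<..} \<and> K \<in> null_sets lebesgue \<and>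
    (\<forall>\<kappa>\<^sub>1 \<kappa>\<^sub>2. 0 < \<kappa>\<^sub>1 \<and> \<kappa>\<^sub>1 \<le> \<kappa>\<^sub>2 \<longrightarrow>
      (\<exists>\<tau>>0. \<forall>\<kappa> \<in> {\<kappa>\<^sub>1..\<kappa>\<^sub>2} - K.
        \<exists>\<nu>>0. \<forall>\<alpha>\<in>multi_indices. \<forall>\<beta>\<in>multi_indices.
          mi_length (\<lambda>j. \<alpha> j + \<beta> j) \<le> enat M \<and> \<not> super_action_preserving \<alpha> \<beta> \<longrightarrow>
          \<bar>freq_dot (Omega g h \<gamma> \<kappa>) (\<lambda>j. int (\<alpha> j) - int (\<beta> j))\<bar>
            > \<nu> / real_of_int (Max (abs ` mi_supp \<alpha> \<beta>)) powr \<tau>))"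
proof -
  define \<tau> where "\<tau> = 2 * M * (2 * M + 6)"
  let ?nonres = "\<lambda>\<kappa>. \<exists>\<nu>>0. \<forall>N\<ge>1. \<forall>\<alpha>\<in>bounded_indices M N. \<forall>\<beta>\<in>bounded_indices M N.
       \<not> super_action_preserving \<alpha> \<beta> \<longrightarrow> \<nu> / real N ^ \<tau> < \<bar>resonance g h \<gamma> \<alpha> \<beta> \<kappa>\<bar>"
  have "\<exists>K. K \<in> null_sets lebesgue \<and> K \<subseteq> {1 / real (Suc q)..real (Suc q)} \<and>
      (\<forall>\<kappa>\<in>{1 / real (Suc q)..real (Suc q)} - K. ?nonres \<kappa>)" for q
    by (rule exceptional_set[OF assms(2,3), of "1 / real (Suc q)" "real (Suc q)" M \<gamma>])
      (auto simp: \<tau>_def simp del: of_nat_Suc)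
  then obtain K where K: "\<And>q. K q \<in> null_sets lebesgue"
      "\<And>q. K q \<subseteq> {1 / real (Suc q)..real (Suc q)}"
      "\<And>q \<kappa>. \<kappa> \<in> {1 / real (Suc q)..real (Suc q)} - K q \<Longrightarrow> ?nonres \<kappa>"
    by metis
  have main: "\<exists>\<nu>>0. \<forall>\<alpha>\<in>multi_indices. \<forall>\<beta>\<in>multi_indices.
      mi_length (\<lambda>j. \<alpha> j + \<beta> j) \<le> enat M \<and> \<not> super_action_preserving \<alpha> \<beta> \<longrightarrow>
      \<bar>freq_dot (Omega g h \<gamma> \<kappa>) (\<lambda>j. int (\<alpha> j) - int (\<beta> j))\<bar>
        > \<nu> / real_of_int (Max (abs ` mi_supp \<alpha> \<beta>)) powr real \<tau>"
    if \<kappa>: "\<kappa> \<in> {\<kappa>\<^sub>1..\<kappa>\<^sub>2} - (\<Union>q. K q)" and "0 < \<kappa>\<^sub>1" for \<kappa> \<kappa>\<^sub>1 \<kappa>\<^sub>2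
  proof -
    obtain q where q: "max (1 / \<kappa>) \<kappa> < real q" using reals_Archimedean2 by blast
    have "0 < \<kappa>" using \<kappa> \<open>0 < \<kappa>\<^sub>1\<close> by auto
    have "1 / \<kappa> \<le> real (Suc q)" "\<kappa> \<le> real (Suc q)"
      using q by auto
    then have "1 / real (Suc q) \<le> \<kappa>" "\<kappa> \<le> real (Suc q)"
      using \<open>0 < \<kappa>\<close> by (auto simp: divide_le_eq mult.commute simp del: of_nat_Suc)
    moreover have "\<kappa> \<notin> K q" using \<kappa> by blast
    ultimately have "?nonres \<kappa>" by (intro K(3)[of \<kappa> q]) simp
    then obtain \<nu> where "0 < \<nu>" and \<nu>: "\<And>N \<alpha> \<beta>. N \<ge> 1 \<Longrightarrow> \<alpha> \<in> bounded_indices M N \<Longrightarrow>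
        \<beta> \<in> bounded_indices M N \<Longrightarrow> \<not> super_action_preserving \<alpha> \<beta> \<Longrightarrow>
        \<nu> / real N ^ \<tau> < \<bar>resonance g h \<gamma> \<alpha> \<beta> \<kappa>\<bar>"
      by blast
    have "\<nu> / real_of_int (Max (abs ` mi_supp \<alpha> \<beta>)) powr real \<tau>
        < \<bar>freq_dot (Omega g h \<gamma> \<kappa>) (\<lambda>j. int (\<alpha> j) - int (\<beta> j))\<bar>"
      if ab: "\<alpha> \<in> multi_indices" "\<beta> \<in> multi_indices" "mi_length (\<lambda>j. \<alpha> j + \<beta> j) \<le> enat M"
        "\<not> super_action_preserving \<alpha> \<beta>" for \<alpha> \<beta>
    proof -
      define m where "m = Max (abs ` mi_supp \<alpha> \<beta>)"
      have fin: "finite (abs ` mi_supp \<alpha> \<beta>)"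
        using finite_support[OF ab(3)] by (simp add: mi_supp_def)
      obtain n where "n \<ge> 1" "\<alpha> (int n) + \<alpha> (- int n) \<noteq> \<beta> (int n) + \<beta> (- int n)"
        using ab(4) by (auto simp: super_action_preserving_def)
      then have "int n \<in> mi_supp \<alpha> \<beta> \<or> - int n \<in> mi_supp \<alpha> \<beta>"
        by (auto simp: mi_supp_def)
      then have "int n \<in> abs ` mi_supp \<alpha> \<beta>" by force
      then have "int n \<le> m" unfolding m_def using fin by (rule Max_ge[rotated])
      then have "1 \<le> m" using \<open>n \<ge> 1\<close> by linarith
      define N where "N = nat m"
      have N: "1 \<le> N" "int N = m" using \<open>1 \<le> m\<close> by (auto simp: N_def)
      have outside: "\<alpha> j + \<beta> j = 0" if "j \<noteq> 0" "j \<notin> modes N" for j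
      proof (rule ccontr)
        assume "\<alpha> j + \<beta> j \<noteq> 0"
        then have "j \<in> mi_supp \<alpha> \<beta>" using that by (simp add: mi_supp_def)
        then have "\<bar>j\<bar> \<le> m" unfolding m_def using fin by (intro Max_ge) auto
        then show False using that N by (auto simp: modes_def)
      qed
      have "(\<Sum>j\<in>modes N. \<alpha> j + \<beta> j) \<le> M"
        by (rule mi_length_le_imp[OF ab(3)]) (auto simp: modes_def)
      then have "(\<Sum>j\<in>modes N. \<alpha> j) \<le> M" "(\<Sum>j\<in>modes N. \<beta> j) \<le> M"
        by (auto simp: sum.distrib)
      then have "\<alpha> \<in> bounded_indices M N" "\<beta> \<in> bounded_indices M N"
        using ab outside by (auto simp: bounded_indices_def)
      then have "\<nu> / real N ^ \<tau> < \<bar>resonance g h \<gamma> \<alpha> \<beta> \<kappa>\<bar>"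
        using \<nu> N(1) ab(4) by blast
      moreover have "real_of_int m powr real \<tau> = real N ^ \<tau>"
        using N(1) unfolding N(2)[symmetric] by (simp add: powr_realpow)
      ultimately show ?thesis by (simp add: m_def resonance_def)
    qed
    with \<open>0 < \<nu>\<close> show ?thesis by blast
  qed
  have "0 < real \<tau>" using \<open>M \<ge> 1\<close> by (simp add: \<tau>_def)
  show ?thesis
  proof (intro exI[of _ "\<Union>q. K q"] conjI allI impI)
    show "(\<Union>q. K q) \<in> null_sets lebesgue" using K(1) by (intro null_sets_UN') auto
    show "(\<Union>q. K q) \<subseteq> {0<..}"
    proof safe
      fix x q assume "x \<in> K q"
      then have "1 / real (Suc q) \<le> x" using K(2) by fastforce
      moreover have "0 < 1 / real (Suc q)" by simp
      ultimately show "0 < x" by linarith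
    qed
  next
    fix \<kappa>\<^sub>1 \<kappa>\<^sub>2 :: real assume pos: "0 < \<kappa>\<^sub>1 \<and> \<kappa>\<^sub>1 \<le> \<kappa>\<^sub>2"
    show "\<exists>\<tau>>0. \<forall>\<kappa> \<in> {\<kappa>\<^sub>1..\<kappa>\<^sub>2} - (\<Union>q. K q).
        \<exists>\<nu>>0. \<forall>\<alpha>\<in>multi_indices. \<forall>\<beta>\<in>multi_indices.
          mi_length (\<lambda>j. \<alpha> j + \<beta> j) \<le> enat M \<and> \<not> super_action_preserving \<alpha> \<beta> \<longrightarrow>
          \<bar>freq_dot (Omega g h \<gamma> \<kappa>) (\<lambda>j. int (\<alpha> j) - int (\<beta> j))\<bar>
            > \<nu> / real_of_int (Max (abs ` mi_supp \<alpha> \<beta>)) powr \<tau>"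
      by (rule exI[of _ "real \<tau>"], rule conjI[OF \<open>0 < real \<tau>\<close>], rule ballI,
          rule main[OF _ conjunct1[OF pos]])
  qed
qed

end
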